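(* Let $d\in\{2,3\}$ and let $k\ge 1$ be an integer. Then the sum $\hat{\mathbf V}^k(\hat E)=\hat{\mathbf V}^{k-1}_{RT}(\hat E)+\tilde{\mathcal B}^k(\hat E)$ is direct, i.e. $\hat{\mathbf V}^k(\hat E)=\hat{\mathbf V}^{k-1}_{RT}(\hat E)\oplus\tilde{\mathcal B}^k(\hat E)$, and $\dim\hat{\mathbf V}^k(\hat E)=\dim\mathcal Q^k(\hat E,\mathbb R^d)$.
   Context: $\hat E=[-1,1]^d$ is the reference element, with coordinates $(\hat x,\hat y)$ if $d=2$ and $(\hat x,\hat y,\hat z)$ if $d=3$. $\mathcal Q^k$ denotes polynomials of degree $\le k$ in each variable, and $\mathcal Q^k(\hat E,\mathbb R^d)$ the $\mathbb R^d$-valued ones (all components in $\mathcal Q^k$). Raviart–Thomas space on $\hat E$ ($m\ge 0$): $\hat{\mathbf V}^m_{RT}(\hat E)=(\mathcal Q^m+\hat x\mathcal Q^m)\times(\mathcal Q^m+\hat y\mathcal Q^m)\times(\mathcal Q^m+\hat z\mathcal Q^m)$ if $d=3$, with the third component omitted if $d=2$. Bubble space: $\tilde{\mathcal B}^k(\hat E)=\sum_{i=1}^d\tilde{\mathcal B}^k_i(\hat E)$, where (a term whose coefficient is zero is understood to be zero) for $d=2$ $$\tilde{\mathcal B}^k_1=\mathrm{span}\{((a_2+1)\hat x^{a_1}\hat y^{a_2},\,-a_1\hat x^{a_1-1}\hat y^{a_2+1})^T:\ 0\le a_1,a_2\le k,\ a_2=k\},$$ $$\tilde{\mathcal B}^k_2=\mathrm{span}\{(-b_2\hat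 x^{b_1+1}\hat y^{b_2-1},\,(b_1+1)\hat x^{b_1}\hat y^{b_2})^T:\ 0\le b_1,b_2\le k,\ b_1=k\},$$ and for $d=3$ $$\tilde{\mathcal B}^k_1=\mathrm{span}\{((a_2+a_3+2)\hat x^{a_1}\hat y^{a_2}\hat z^{a_3},\,-a_1\hat x^{a_1-1}\hat y^{a_2+1}\hat z^{a_3},\,-a_1\hat x^{a_1-1}\hat y^{a_2}\hat z^{a_3+1})^T:\ 0\le a_i\le k,\ a_2=k\text{ or }a_3=k\},$$ $$\tilde{\mathcal B}^k_2=\mathrm{span}\{(-b_2\hat x^{b_1+1}\hat y^{b_2-1}\hat z^{b_3},\,(b_1+b_3+2)\hat x^{b_1}\hat y^{b_2}\hat z^{b_3},\,-b_2\hat x^{b_1}\hat y^{b_2-1}\hat z^{b_3+1})^T:\ 0\le b_i\le k,\ b_1=k\text{ or }b_3=k\},$$ $$\tilde{\mathcal B}^k_3=\mathrm{span}\{(-c_3\hat x^{c_1+1}\hat y^{c_2}\hat z^{c_3-1},\,-c_3\hat x^{c_1}\hat y^{c_2+1}\hat z^{c_3-1},\,(c_1+c_2+2)\hat x^{c_1}\hat y^{c_2}\hat z^{c_3})^T:\ 0\le c_i\le k,\ c_1=k\text{ or }c_2=k\}.$$ (Equivalently, $\tilde{\mathcal B}^k_i=\hat\nabla\times(\hat{\mathbf x}\times\mathcal B^k_i)$, where $\mathcal B^k_i$ is spanned by the vectors whose only nonzero entry is the $i$-th, equal to a monomial in $\mathcal Q^k$ having degree exactly $k$ in some variable other than the $i$-th.)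 *)

theory Defs
  imports "HOL-Analysis.Analysis" "HOL-Library.Function_Algebras" "HOL-Library.Set_Algebras"
begin

text \<open>Pointwise scalar multiplication, complementing the pointwise addition of
  \<^theory>\<open>HOL-Library.Function_Algebras\<close>, so that \<^const>\<open>span\<close>,
  \<^const>\<open>subspace\<close> and \<^const>\<open>dim\<close> apply to sets of functions.\<close>

instantiation "fun" :: (type, real_vector) real_vector
begin

definition scaleR_fun :: "real \<Rightarrow> ('a \<Rightarrow> 'b) \<Rightarrow> 'a \<Rightarrow> 'b"
  where "scaleR_fun c f = (\<lambda>x. c *\<^sub>R f x)"

instance
proof
  fix a b :: real and f g :: "'a \<Rightarrow> 'b"
  show "a *\<^sub>R (f + g) = a *\<^sub>R f + a *\<^sub>R g"
    by (rule ext) (simp add: scaleR_fun_def scaleR_add_right)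
  show "(a + b) *\<^sub>R f = a *\<^sub>R f + b *\<^sub>R f"
    by (rule ext) (simp add: scaleR_fun_def scaleR_add_left)
  show "a *\<^sub>R b *\<^sub>R f = (a * b) *\<^sub>R f"
    by (rule ext) (simp add: scaleR_fun_def)
  show "1 *\<^sub>R f = f"
    by (rule ext) (simp add: scaleR_fun_def)
qed

end

text \<open>The dimension \<open>d\<close> is \<open>CARD('n)\<close>.\<close>

definition ref_elem :: "(real ^ 'n) set"
  where "ref_elem = cbox (vec (-1)) (vec 1)"

text \<open>A function on the reference element is represented by its extension by zero to
  \<open>real ^ 'n\<close>; two such extensions are equal iff the functions agree on the reference element.\<close>

definition on_ref :: "(real ^ 'n \<Rightarrow> 'b::zero) \<Rightarrow> real ^ 'n \<Rightarrow> 'b"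
  where "on_ref f = (\<lambda>x. if x \<in> ref_elem then f x else 0)"

definition mono_fun :: "('n::finite \<Rightarrow> nat) \<Rightarrow> real ^ 'n \<Rightarrow> real"
  where "mono_fun a x = (\<Prod>i\<in>UNIV. (x $ i) ^ a i)"

definition Q_space :: "nat \<Rightarrow> (real ^ 'n::finite \<Rightarrow> real) set"
  where "Q_space k = span {on_ref (mono_fun a) | a. \<forall>i. a i \<le> k}"

definition Q_vec_space :: "nat \<Rightarrow> (real ^ 'n::finite \<Rightarrow> real ^ 'n) set"
  where "Q_vec_space k = {v. \<forall>i. (\<lambda>x. v x $ i) \<in> Q_space k}"

text \<open>The sum below, like all sums of sets in this theory, is the elementwise sum of
  \<^theory>\<open>HOL-Library.Set_Algebras\<close>.\<close>

definition RT_space :: "nat \<Rightarrow> (real ^ 'n::finite \<Rightarrow> real ^ 'n) set"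
  where "RT_space m =
    {v. \<forall>i. (\<lambda>x. v x $ i) \<in> Q_space m + (\<lambda>q x. x $ i * q x) ` Q_space m}"

text \<open>One formula covers all generators for \<open>d = 2\<close> and \<open>d = 3\<close>: the \<open>i\<close>-th component has
  coefficient \<open>a\<^sub>2 + 1\<close> (\<open>d = 2\<close>) or \<open>a\<^sub>2 + a\<^sub>3 + 2\<close> (\<open>d = 3\<close>) for \<open>i = 1\<close>, i.e. the sum of
  \<open>a\<^sub>l + 1\<close> over \<open>l \<noteq> i\<close>, and similarly for the other \<open>i\<close>; every other component \<open>j\<close> moves one
  power from the variable \<open>i\<close> to the variable \<open>j\<close>. When \<open>a i = 0\<close> the truncated subtraction
  is harmless, since the coefficient \<open>- a i\<close> vanishes. The explicit formulas are derived below
  in \<open>bubble_gen_2D\<close> and \<open>bubble_gen_3D\<close>.\<close>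

definition bubble_gen :: "'n::finite \<Rightarrow> ('n \<Rightarrow> nat) \<Rightarrow> real ^ 'n \<Rightarrow> real ^ 'n"
  where "bubble_gen i a = on_ref (\<lambda>x. \<chi> j.
    if j = i then (\<Sum>l\<in>UNIV - {i}. real (a l) + 1) * mono_fun a x
    else - real (a i) * mono_fun (a(i := a i - 1, j := a j + 1)) x)"

definition bubble_part :: "nat \<Rightarrow> 'n::finite \<Rightarrow> (real ^ 'n \<Rightarrow> real ^ 'n) set"
  where "bubble_part k i =
    span {bubble_gen i a | a. (\<forall>l. a l \<le> k) \<and> (\<exists>l. l \<noteq> i \<and> a l = k)}"

definition bubble_space :: "nat \<Rightarrow> (real ^ 'n::finite \<Rightarrow> real ^ 'n) set"
  where "bubble_space k = (\<Sum>i\<in>UNIV. bubble_part k i)"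

definition V_space :: "nat \<Rightarrow> (real ^ 'n::finite \<Rightarrow> real ^ 'n) set"
  where "V_space k = RT_space (k - 1) + bubble_space k"

definition is_direct_sum :: "'v::real_vector set \<Rightarrow> 'v set \<Rightarrow> 'v set \<Rightarrow> bool"
  where "is_direct_sum V A B \<longleftrightarrow>
    subspace A \<and> subspace B \<and> V = A + B \<and> A \<inter> B = {0}"

lemma bubble_gen_2D:
  fixes a :: "2 \<Rightarrow> nat"
  shows "bubble_gen 1 a = on_ref (\<lambda>x. vector
      [(a 2 + 1) * x$1 ^ a 1 * x$2 ^ a 2,
       - real (a 1) * x$1 ^ (a 1 - 1) * x$2 ^ (a 2 + 1)])" (is ?A)
    and "bubble_gen 2 a = on_ref (\<lambda>x. vector
      [- real (a 2) * x$1 ^ (a 1 + 1) * x$2 ^ (a 2 - 1),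
       (a 1 + 1) * x$1 ^ a 1 * x$2 ^ a 2])" (is ?B)
proof -
  have compl: "UNIV - {1::2} = {2}" "UNIV - {2::2} = {1}"
    unfolding UNIV_2 by auto
  have mono: "mono_fun b x = x$1 ^ b 1 * x$2 ^ b 2" for b :: "2 \<Rightarrow> nat" and x
    unfolding mono_fun_def UNIV_2 by simp
  show ?A
    unfolding bubble_gen_def
    by (intro arg_cong[where f = on_ref] ext)
      (simp only: vec_eq_iff forall_2 vector_2 vec_lambda_beta compl mono, simp add: algebra_simps)
  show ?B
    unfolding bubble_gen_def
    by (intro arg_cong[where f = on_ref] ext)
      (simp only: vec_eq_iff forall_2 vector_2 vec_lambda_beta compl mono, simp add: algebra_simps)
qed

lemma bubble_gen_3D:
  fixes a :: "3 \<Rightarrow> nat"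
  shows "bubble_gen 1 a = on_ref (\<lambda>x. vector
      [(a 2 + a 3 + 2) * x$1 ^ a 1 * x$2 ^ a 2 * x$3 ^ a 3,
       - real (a 1) * x$1 ^ (a 1 - 1) * x$2 ^ (a 2 + 1) * x$3 ^ a 3,
       - real (a 1) * x$1 ^ (a 1 - 1) * x$2 ^ a 2 * x$3 ^ (a 3 + 1)])" (is ?A)
    and "bubble_gen 2 a = on_ref (\<lambda>x. vector
      [- real (a 2) * x$1 ^ (a 1 + 1) * x$2 ^ (a 2 - 1) * x$3 ^ a 3,
       (a 1 + a 3 + 2) * x$1 ^ a 1 * x$2 ^ a 2 * x$3 ^ a 3,
       - real (a 2) * x$1 ^ a 1 * x$2 ^ (a 2 - 1) * x$3 ^ (a 3 + 1)])" (is ?B)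
    and "bubble_gen 3 a = on_ref (\<lambda>x. vector
      [- real (a 3) * x$1 ^ (a 1 + 1) * x$2 ^ a 2 * x$3 ^ (a 3 - 1),
       - real (a 3) * x$1 ^ a 1 * x$2 ^ (a 2 + 1) * x$3 ^ (a 3 - 1),
       (a 1 + a 2 + 2) * x$1 ^ a 1 * x$2 ^ a 2 * x$3 ^ a 3])" (is ?C)
proof -
  have compl: "UNIV - {1::3} = {2, 3}" "UNIV - {2::3} = {1, 3}" "UNIV - {3::3} = {1, 2}"
    unfolding UNIV_3 by auto
  have mono: "mono_fun b x = x$1 ^ b 1 * x$2 ^ b 2 * x$3 ^ b 3" for b :: "3 \<Rightarrow> nat" and x
    unfolding mono_fun_def UNIV_3 by simp
  show ?A
    unfolding bubble_gen_def
    by (intro arg_cong[where f = on_ref] ext)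
      (simp only: vec_eq_iff forall_3 vector_3 vec_lambda_beta compl mono, simp add: algebra_simps)
  show ?B
    unfolding bubble_gen_def
    by (intro arg_cong[where f = on_ref] ext)
      (simp only: vec_eq_iff forall_3 vector_3 vec_lambda_beta compl mono, simp add: algebra_simps)
  show ?C
    unfolding bubble_gen_def
    by (intro arg_cong[where f = on_ref] ext)
      (simp only: vec_eq_iff forall_3 vector_3 vec_lambda_beta compl mono, simp add: algebra_simps)
qed

end

theory Submission
  imports Defs
begin

text \<open>
  Write \<open>x\<^sup>a\<close> for the monomial with exponent \<open>a\<close>, \<open>\<bar>a\<bar>\<close> for its total degree, \<open>e\<^sub>i\<close> for the \<open>i\<close>-th unit vector and \<open>d\<close> for the
  dimension. The fields \<open>x\<^sup>a e\<^sub>i\<close> with all \<open>a l \<le> k\<close> form a basis of the vector-valued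
  \<open>Q\<^sup>k\<close>, so its dimension is the number of pairs \<open>(i, a)\<close>. These pairs split into two disjoint
  classes: those with \<open>a l < k\<close> for every \<open>l \<noteq> i\<close>, whose fields \<open>x\<^sup>a e\<^sub>i\<close> span the Raviart--Thomas
  space of order \<open>k - 1\<close>, and those with \<open>a l = k\<close> for some \<open>l \<noteq> i\<close>, which are exactly the indices
  of the bubble generators. Both assertions therefore follow once the family \<open>V_basis\<close>,
  consisting of the monomial fields of the first class and the bubble generators of the second
  class, is known to be linearly independent (\<open>V_basis_coefficients_zero\<close>): the two halves of an
  independent family span spaces with trivial intersection, and the whole family has as many
  members as the basis of \<open>Q\<^sup>k\<close>.

  The reason for independence is an Euler-type identity. The generator belonging to the field
  \<open>u = x\<^sup>a e\<^sub>i\<close> equals \<open>(\<bar>a\<bar> + d - 1) u - x div u\<close>, where \<open>x\<close> is the position vector. Suppose that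
  a combination vanishes, let \<open>u\<close> be the corresponding combination of the fields
  \<open>x\<^sup>a e\<^sub>i\<close> of the second class, and put \<open>g = div u\<close>. A monomial \<open>m\<close> of \<open>g\<close> still has exponent \<open>k\<close> in
  some variable \<open>l\<close>. In the \<open>l\<close>-th component the product of \<open>x\<^sub>l\<close> with \<open>m\<close> has degree \<open>k + 1\<close> in
  that variable, whereas all the fields \<open>x\<^sup>a e\<^sub>i\<close> have degree at most \<open>k\<close>, so
  nothing can cancel it. Hence \<open>g = 0\<close>. What remains is a combination of distinct monomial fields with positive weights, so all
  coefficients vanish. This is the content of \<open>bubble_equations_force_zero\<close>, stated
  for the coefficients of the monomials; that coefficients may be compared at all is
  \<open>mono_fun_independent\<close>.
\<close>

section \<open>Linear independence of monomials on the reference element\<close>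

lemma mem_ref_elem: "x \<in> ref_elem \<longleftrightarrow> (\<forall>i. \<bar>x $ i\<bar> \<le> 1)"
  by (auto simp: ref_elem_def mem_box_cart vec_def abs_le_iff)

lemma mono_fun_mult:
  "mono_fun a (\<chi> i. x $ i * y $ i) = mono_fun a x * mono_fun a y"
  by (simp add: mono_fun_def power_mult_distrib prod.distrib)

lemma mono_fun_separated:
  fixes a b :: "'n::finite \<Rightarrow> nat"
  assumes "a \<noteq> b"
  obtains y where "y \<in> ref_elem" "mono_fun a y \<noteq> mono_fun b y"
proof -
  obtain i where i: "a i \<noteq> b i" using assms by auto
  define y :: "real ^ 'n" where "y = (\<chi> l. if l = i then 1 / 2 else 1)"
  have "mono_fun e y = (1 / 2) ^ e i" for e :: "'n \<Rightarrow> nat"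
  proof -
    have "mono_fun e y = (\<Prod>l\<in>UNIV. if l = i then (1 / 2) ^ e i else 1)"
      unfolding mono_fun_def y_def by (intro prod.cong) auto
    then show ?thesis by simp
  qed
  moreover have "(1 / 2 :: real) ^ a i \<noteq> (1 / 2) ^ b i"
    using i by (simp add: power_one_over)
  ultimately show ?thesis
    by (intro that[of y]) (auto simp: mem_ref_elem y_def)
qed

text \<open>Monomials are multiplicative on the cube, which is closed under componentwise
  multiplication. Distinct monomials are thus distinct characters of a monoid, and
  Dedekind's argument applies: multiplying a relation by the value of one of its characters at
  \<open>y\<close>, and subtracting the same relation evaluated at the product with \<open>y\<close>, eliminates this
  character.\<close>

lemma mono_fun_independent:
  fixes A :: "('n::finite \<Rightarrow> nat) set"
  assumes "finite A"
    and "\<And>x. x \<in> ref_elem \<Longrightarrow> (\<Sum>a\<in>A. c a * mono_fun a x) = 0"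
  shows "\<forall>a\<in>A. c a = 0"
  using assms
proof (induction A arbitrary: c rule: finite_induct)
  case empty
  then show ?case by simp
next
  case (insert b A)
  have zero: "c b * mono_fun b x + (\<Sum>a\<in>A. c a * mono_fun a x) = 0" if "x \<in> ref_elem" for x
    using insert.prems[OF that] insert.hyps by simp
  have diff: "c a * (mono_fun b y - mono_fun a y) = 0" if y: "y \<in> ref_elem" and "a \<in> A" for a y
  proof -
    have "(\<Sum>a\<in>A. c a * (mono_fun b y - mono_fun a y) * mono_fun a x) = 0"
      if x: "x \<in> ref_elem" for x
    proof -
      have "(\<chi> i. x $ i * y $ i) \<in> ref_elem"
        using x y by (auto simp: mem_ref_elem abs_mult intro!: mult_le_one)
      from zero[OF this]
      have "c b * mono_fun b x * mono_fun b y
          + (\<Sum>a\<in>A. c a * mono_fun a x * mono_fun a y) = 0"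
        by (simp add: mono_fun_mult mult.assoc)
      moreover have "c b * mono_fun b x * mono_fun b y
          + (\<Sum>a\<in>A. c a * mono_fun a x * mono_fun b y) = 0"
        using arg_cong[OF zero[OF x], of "\<lambda>t. t * mono_fun b y"]
        by (simp add: distrib_right sum_distrib_right)
      ultimately show ?thesis
        by (simp add: algebra_simps sum_subtractf)
    qed
    with insert.IH[of "\<lambda>a. c a * (mono_fun b y - mono_fun a y)"] \<open>a \<in> A\<close>
    show ?thesis by blast
  qed
  have A0: "c a = 0" if "a \<in> A" for a
  proof -
    have "b \<noteq> a" using that insert.hyps by auto
    then obtain y where "y \<in> ref_elem" "mono_fun b y \<noteq> mono_fun a y"
      by (rule mono_fun_separated)
    with diff[OF _ that] show ?thesis by auto
  qed
  have "vec 1 \<in> (ref_elem :: (real ^ 'n) set)" "mono_fun b (vec 1) = 1"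
    by (simp_all add: mem_ref_elem mono_fun_def)
  with zero[of "vec 1"] A0 have "c b = 0" by simp
  with A0 show ?case by simp
qed

text \<open>The family \<open>\<mu>\<close> of exponents may have repetitions, so only the total
  coefficient of each monomial is determined.\<close>

lemma coefficients_vanish:
  fixes \<mu> :: "'p \<Rightarrow> 'n::finite \<Rightarrow> nat"
  assumes fin: "finite P"
    and zero: "\<And>x. x \<in> ref_elem \<Longrightarrow> (\<Sum>p\<in>P. c p * mono_fun (\<mu> p) x) = 0"
  shows "(\<Sum>p | p \<in> P \<and> \<mu> p = m. c p) = 0"
proof (cases "m \<in> \<mu> ` P")
  case True
  have "(\<Sum>m\<in>\<mu> ` P. (\<Sum>p | p \<in> P \<and> \<mu> p = m. c p) * mono_fun m x) = 0"
    if "x \<in> ref_elem" for x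
  proof -
    have "(\<Sum>m\<in>\<mu> ` P. (\<Sum>p | p \<in> P \<and> \<mu> p = m. c p) * mono_fun m x)
        = (\<Sum>m\<in>\<mu> ` P. \<Sum>p | p \<in> P \<and> \<mu> p = m. c p * mono_fun (\<mu> p) x)"
      by (simp add: sum_distrib_right)
    also have "\<dots> = (\<Sum>p\<in>P. c p * mono_fun (\<mu> p) x)"
      by (rule sum.image_gen[OF fin, symmetric])
    finally show ?thesis using zero[OF that] by simp
  qed
  from mono_fun_independent[OF _ this] fin True show ?thesis by blast
next
  case False
  then have "{p. p \<in> P \<and> \<mu> p = m} = {}" by auto
  then show ?thesis by (simp only: sum.empty)
qed

section \<open>Spans of vector fields and of families\<close>

lemma sum_of_spans: "span A + span B = span (A \<union> B)"
  by (auto simp: span_Un set_plus_def)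

lemma finite_sum_of_spans:
  "finite I \<Longrightarrow> (\<Sum>i\<in>I. span (A i)) = span (\<Union>i\<in>I. A i)"
  by (induction I rule: finite_induct) (simp_all add: sum_of_spans)

text \<open>The coordinates of a common element are supported in \<open>A\<close> and also in \<open>B\<close>.\<close>

lemma span_Int_span_of_disjoint:
  assumes "independent (A \<union> B)" and "A \<inter> B = {}"
  shows "span A \<inter> span B = {0}"
proof -
  have "x = 0" if "x \<in> span A" "x \<in> span B" for x
  proof -
    have "representation (A \<union> B) x = representation A x"
      "representation (A \<union> B) x = representation B x"
      using that assms(1) by (auto intro!: representation_extend)
    then have "representation (A \<union> B) x b = 0" for b
      using representation_ne_zero[of A x b] representation_ne_zero[of B x b] assms(2) by auto
    moreover have "x \<in> span (A \<union> B)"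
      using that(1) span_mono[of A "A \<union> B"] by auto
    ultimately show "x = 0"
      using sum_nonzero_representation_eq[OF assms(1), of x] by simp
  qed
  then show ?thesis by (auto simp: span_zero)
qed

text \<open>Independence of a family, unlike that of its range, also excludes repetitions; this is
  what makes the cardinality of the index set equal to the dimension of the span.\<close>

lemma independent_family:
  assumes fin: "finite P"
    and zero: "\<And>c. (\<Sum>p\<in>P. c p *\<^sub>R F p) = 0 \<Longrightarrow> \<forall>p\<in>P. c p = 0"
  shows "inj_on F P" and "independent (F ` P)"
proof -
  show inj: "inj_on F P"
  proof (rule inj_onI, rule ccontr)
    fix p q assume pq: "p \<in> P" "q \<in> P" "F p = F q" "p \<noteq> q"
    define c where "c r = (if r = p then 1 else 0) - (if r = q then 1 else (0::real))" for r
    have "(\<Sum>r\<in>P. c r *\<^sub>R F r) = F p - F q"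
      using fin pq by (simp add: c_def scaleR_diff_left sum_subtractf if_distrib[of "\<lambda>t. t *\<^sub>R _"] cong: if_cong)
    with zero[of c] pq show False by (auto simp: c_def)
  qed
  show "independent (F ` P)"
  proof
    assume "dependent (F ` P)"
    then obtain u p where u: "p \<in> P" "u (F p) \<noteq> 0" "(\<Sum>v\<in>F ` P. u v *\<^sub>R v) = 0"
      using fin by (auto simp: dependent_finite)
    then have "(\<Sum>p\<in>P. u (F p) *\<^sub>R F p) = 0"
      by (simp add: sum.reindex[OF inj])
    with zero[of "u \<circ> F"] u show False by auto
  qed
qed

lemma sum_fun_apply: "(\<Sum>p\<in>P. f p) x = (\<Sum>p\<in>P. f p x)"
  for f :: "'p \<Rightarrow> 'a \<Rightarrow> 'b::comm_monoid_add"
  by (induction P rule: infinite_finite_induct) simp_all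

definition comp_field :: "'n \<Rightarrow> ('a \<Rightarrow> real) \<Rightarrow> 'a \<Rightarrow> real ^ 'n::finite"
  where "comp_field i f = (\<lambda>x. axis i (f x))"

lemma comp_field_nth: "comp_field i f x $ j = (if i = j then f x else 0)"
  by (simp add: comp_field_def axis_def)

lemma linear_comp_field: "linear (comp_field i)"
  by (rule linearI) (auto simp: fun_eq_iff vec_eq_iff comp_field_nth scaleR_fun_def)

lemma linear_component: "linear (\<lambda>(v::'a \<Rightarrow> real ^ 'n::finite) x. v x $ i)"
  by (rule linearI) (auto simp: fun_eq_iff scaleR_fun_def)

lemma componentwise_span:
  fixes M :: "'n::finite \<Rightarrow> ('a \<Rightarrow> real) set"
  shows "{v. \<forall>i. (\<lambda>x. v x $ i) \<in> span (M i)} = span (\<Union>i. comp_field i ` M i)"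
    (is "?L = span ?G")
proof
  show "?L \<subseteq> span ?G"
  proof
    fix v assume v: "v \<in> ?L"
    have "comp_field i (\<lambda>x. v x $ i) \<in> span ?G" for i
    proof -
      have "comp_field i (\<lambda>x. v x $ i) \<in> span (comp_field i ` M i)"
        using v by (auto simp: linear_span_image[OF linear_comp_field])
      also have "\<dots> \<subseteq> span ?G" by (intro span_mono) auto
      finally show ?thesis .
    qed
    then have "(\<Sum>i\<in>UNIV. comp_field i (\<lambda>x. v x $ i)) \<in> span ?G"
      by (intro span_sum)
    also have "(\<Sum>i\<in>UNIV. comp_field i (\<lambda>x. v x $ i)) = v"
      by (rule ext) (simp add: vec_eq_iff sum_fun_apply comp_field_nth)
    finally show "v \<in> span ?G" .
  qed
  show "span ?G \<subseteq> ?L"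
  proof (rule span_minimal)
    show "?G \<subseteq> ?L"
    proof clarify
      fix i j f assume "f \<in> M i"
      have "(\<lambda>x. comp_field i f x $ j) = (if i = j then f else 0)"
        by (auto simp: comp_field_nth fun_eq_iff)
      with \<open>f \<in> M i\<close> show "(\<lambda>x. comp_field i f x $ j) \<in> span (M j)"
        by (auto simp: span_base span_zero)
    qed
    have "?L = (\<Inter>i. (\<lambda>v x. v x $ i) -` span (M i))" by auto
    then show "subspace ?L"
      by (auto intro!: subspace_Inter linear_subspace_vimage linear_component)
  qed
qed

section \<open>Generators of the three spaces\<close>

text \<open>In each of the following index sets a pair \<open>(i, a)\<close> stands for the monomial with
  exponent \<open>a\<close> placed in component \<open>i\<close>.\<close>

definition full_idx :: "nat \<Rightarrow> ('n::finite \<times> ('n \<Rightarrow> nat)) set"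
  where "full_idx k = {(i, a). \<forall>l. a l \<le> k}"

definition RT_idx :: "nat \<Rightarrow> ('n::finite \<times> ('n \<Rightarrow> nat)) set"
  where "RT_idx k = {(i, a). a i \<le> k \<and> (\<forall>l. l \<noteq> i \<longrightarrow> a l < k)}"

definition bubble_idx :: "nat \<Rightarrow> ('n::finite \<times> ('n \<Rightarrow> nat)) set"
  where "bubble_idx k = {(i, a). (\<forall>l. a l \<le> k) \<and> (\<exists>l. l \<noteq> i \<and> a l = k)}"

lemma idx_partition:
  "full_idx k = RT_idx k \<union> bubble_idx k" "RT_idx k \<inter> bubble_idx k = {}"
  unfolding full_idx_def RT_idx_def bubble_idx_def
  by (auto simp: less_le) (metis order_refl)+

lemma finite_full_idx: "finite (full_idx k :: ('n::finite \<times> ('n \<Rightarrow> nat)) set)"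
proof -
  have "full_idx k = UNIV \<times> (PiE UNIV (\<lambda>_. {..k}) :: ('n \<Rightarrow> nat) set)"
    by (auto simp: full_idx_def PiE_def)
  then show ?thesis by (simp add: finite_PiE)
qed

definition mono_field :: "'n::finite \<times> ('n \<Rightarrow> nat) \<Rightarrow> real ^ 'n \<Rightarrow> real ^ 'n"
  where "mono_field p = comp_field (fst p) (on_ref (mono_fun (snd p)))"

lemma Q_vec_space_span:
  "Q_vec_space k = span (mono_field ` full_idx k :: (real ^ 'n::finite \<Rightarrow> real ^ 'n) set)"
proof -
  have "(\<Union>i::'n. comp_field i ` {on_ref (mono_fun a) | a :: 'n \<Rightarrow> nat. \<forall>l. a l \<le> k}) = mono_field ` full_idx k"
    by (force simp: mono_field_def full_idx_def)
  with componentwise_span[of "\<lambda>i::'n. {on_ref (mono_fun a) | a :: 'n \<Rightarrow> nat. \<forall>l. a l \<le> k}"]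
  show ?thesis by (simp add: Q_vec_space_def Q_space_def)
qed

lemma mult_coordinate_mono:
  "x $ i * on_ref (mono_fun a) x = on_ref (mono_fun (a(i := a i + 1))) x"
proof -
  have "mono_fun (a(i := a i + 1)) x = x $ i * mono_fun a x"
  proof -
    have "mono_fun (a(i := a i + 1)) x = (\<Prod>l\<in>UNIV. (if l = i then x $ i else 1) * x $ l ^ a l)"
      unfolding mono_fun_def by (intro prod.cong) auto
    then show ?thesis by (simp add: prod.distrib mono_fun_def)
  qed
  then show ?thesis by (simp add: on_ref_def)
qed

text \<open>Multiplication by the \<open>i\<close>-th coordinate raises the \<open>i\<close>-th exponent bound by one and leaves
  the other bounds unchanged. The index set uses the strict bound \<open>< Suc m\<close> for those, so that with
  \<open>k = Suc m\<close> its complement in \<open>full_idx k\<close> is \<open>bubble_idx k\<close>.\<close>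

lemma RT_component_span:
  "Q_space m + (\<lambda>q x. x $ i * q x) ` Q_space m
     = span {on_ref (mono_fun a) | a. (i, a) \<in> RT_idx (Suc m)}"
proof -
  let ?M = "{on_ref (mono_fun a) | a. \<forall>l. a l \<le> m}"
  let ?X = "\<lambda>(q :: real ^ 'a \<Rightarrow> real) x. x $ i * q x"
  have "linear ?X"
    by (rule linearI) (auto simp: fun_eq_iff scaleR_fun_def algebra_simps)
  then have "Q_space m + ?X ` Q_space m = span (?M \<union> ?X ` ?M)"
    by (simp add: Q_space_def linear_span_image[symmetric] sum_of_spans)
  also have "?M \<union> ?X ` ?M = {on_ref (mono_fun a) | a. (i, a) \<in> RT_idx (Suc m)}" (is "_ = ?R")
  proof
    show "?M \<union> ?X ` ?M \<subseteq> ?R"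
    proof clarify
      fix f assume "f \<in> ?M \<union> ?X ` ?M"
      then obtain a where a: "\<forall>l. a l \<le> m"
        and "f = on_ref (mono_fun a) \<or> f = on_ref (mono_fun (a(i := a i + 1)))"
        by (auto simp: mult_coordinate_mono)
      moreover have "(i, a) \<in> RT_idx (Suc m)" "(i, a(i := a i + 1)) \<in> RT_idx (Suc m)"
        using a by (auto simp: RT_idx_def less_Suc_eq_le le_SucI)
      ultimately show "\<exists>a. f = on_ref (mono_fun a) \<and> (i, a) \<in> RT_idx (Suc m)" by blast
    qed
    show "?R \<subseteq> ?M \<union> ?X ` ?M"
    proof
      fix f assume "f \<in> ?R"
      then obtain a where a: "f = on_ref (mono_fun a)" "a i \<le> Suc m" "\<forall>l. l \<noteq> i \<longrightarrow> a l \<le> m"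
        by (auto simp: RT_idx_def less_Suc_eq_le)
      show "f \<in> ?M \<union> ?X ` ?M"
      proof (cases "a i \<le> m")
        case True
        with a have "\<forall>l. a l \<le> m" by metis
        with a show ?thesis by auto
      next
        case False
        with a have ai: "a i = Suc m" by simp
        have "f = ?X (on_ref (mono_fun (a(i := m))))"
          using a(1) ai by (simp add: mult_coordinate_mono fun_upd_idem)
        moreover have "on_ref (mono_fun (a(i := m))) \<in> ?M" using a by auto
        ultimately show ?thesis by blast
      qed
    qed
  qed
  finally show ?thesis .
qed

lemma RT_space_span:
  "RT_space m = span (mono_field ` RT_idx (Suc m) :: (real ^ 'n::finite \<Rightarrow> real ^ 'n) set)"
proof -
  have "(\<Union>i::'n. comp_field i ` {on_ref (mono_fun a) | a. (i, a) \<in> RT_idx (Suc m)})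
      = mono_field ` RT_idx (Suc m)"
    by (force simp: mono_field_def)
  with componentwise_span[of "\<lambda>i::'n. {on_ref (mono_fun a) | a. (i, a) \<in> RT_idx (Suc m)}"]
  show ?thesis by (simp add: RT_space_def RT_component_span)
qed

lemma bubble_space_span:
  "bubble_space k
    = span ((\<lambda>(i, a). bubble_gen i a) ` bubble_idx k :: (real ^ 'n::finite \<Rightarrow> real ^ 'n) set)"
proof -
  have "(\<Union>i::'n. {bubble_gen i a | a. (\<forall>l. a l \<le> k) \<and> (\<exists>l. l \<noteq> i \<and> a l = k)})
      = (\<lambda>(i, a). bubble_gen i a) ` bubble_idx k"
    by (force simp: bubble_idx_def)
  then show ?thesis
    by (simp add: bubble_space_def bubble_part_def finite_sum_of_spans)
qed

section \<open>Independence of the combined family\<close>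

definition raise :: "'n \<Rightarrow> ('n \<Rightarrow> nat) \<Rightarrow> 'n \<Rightarrow> nat"
  where "raise j a = a(j := a j + 1)"

definition lower :: "'n \<Rightarrow> ('n \<Rightarrow> nat) \<Rightarrow> 'n \<Rightarrow> nat"
  where "lower i a = a(i := a i - 1)"

text \<open>This is \<open>\<bar>a\<bar> + d - 1\<close>, written without subtraction so that its positivity is
  evident.\<close>

definition bubble_weight :: "'n::finite \<Rightarrow> ('n \<Rightarrow> nat) \<Rightarrow> real"
  where "bubble_weight i a = (\<Sum>l\<in>UNIV - {i}. real (a l) + 1) + real (a i)"

text \<open>The componentwise form of \<open>(\<bar>a\<bar> + d - 1) u - x div u\<close> for \<open>u = x\<^sup>a e\<^sub>i\<close>: the divergence of
  \<open>u\<close> is \<open>a i\<close> times the monomial with the \<open>i\<close>-th exponent lowered. The second summand now has the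
  same form in every component, because in component \<open>i\<close> lowering and raising cancel when
  \<open>a i > 0\<close>, and the coefficient vanishes otherwise.\<close>

lemma bubble_gen_nth:
  assumes "x \<in> ref_elem"
  shows "bubble_gen i a x $ j
    = (if i = j then bubble_weight i a * mono_fun a x else 0)
      - real (a i) * mono_fun (raise j (lower i a)) x"
proof (cases "a i = 0")
  case True
  with assms show ?thesis by (auto simp: bubble_gen_def on_ref_def bubble_weight_def)
next
  case False
  then have "raise i (lower i a) = a" by (auto simp: raise_def lower_def)
  moreover have "raise j (lower i a) = a(i := a i - 1, j := a j + 1)" if "i \<noteq> j"
    using that by (simp add: raise_def lower_def)
  ultimately show ?thesis
    using assms by (auto simp: bubble_gen_def on_ref_def bubble_weight_def algebra_simps)
qed

lemma bubble_weight_pos: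
  assumes "(i, a) \<in> bubble_idx k"
  shows "bubble_weight i a > 0"
proof -
  obtain l where "l \<in> UNIV - {i}" using assms by (auto simp: bubble_idx_def)
  then have "(\<Sum>l\<in>UNIV - {i}. real (a l) + 1) > 0"
    by (intro sum_pos) auto
  then show ?thesis by (simp add: bubble_weight_def)
qed

definition V_basis :: "nat \<Rightarrow> 'n::finite \<times> ('n \<Rightarrow> nat) \<Rightarrow> real ^ 'n \<Rightarrow> real ^ 'n"
  where "V_basis k p = (if p \<in> bubble_idx k then bubble_gen (fst p) (snd p) else mono_field p)"

lemma raise_eq_iff: "raise j b = a \<longleftrightarrow> a j \<noteq> 0 \<and> b = lower j a"
  by (auto simp: raise_def lower_def fun_eq_iff)

text \<open>The hypothesis compares the coefficients of the monomial with exponent \<open>m\<close> in component \<open>j\<close> of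
  a vanishing combination: the left-hand side comes from the fields \<open>x\<^sup>a e\<^sub>i\<close>, weighted by
  \<open>\<bar>a\<bar> + d - 1\<close> if they stem from a bubble generator and by \<open>1\<close> otherwise; the right-hand
  side comes from the product of the position vector with the divergence \<open>g\<close>. Up to the raising of
  \<open>x\<^sub>j\<close>, the right-hand side is a coefficient of \<open>g\<close>, for the same \<open>g\<close> in every component. A monomial that
  could occur in \<open>g\<close> has an exponent equal to \<open>k\<close> in some direction \<open>l\<close>, and the equation in component \<open>l\<close>
  for this monomial raised in direction \<open>l\<close> has zero left-hand side. Thus \<open>g = 0\<close>, and the equations
  become \<open>w p * c p = 0\<close>.\<close>

lemma bubble_equations_force_zero:
  fixes c w :: "'n::finite \<times> ('n \<Rightarrow> nat) \<Rightarrow> real"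
  assumes eq: "\<And>j m. (if (j, m) \<in> full_idx k then w (j, m) * c (j, m) else 0)
      = (\<Sum>q | q \<in> bubble_idx k \<and> raise j (lower (fst q) (snd q)) = m. c q * real (snd q (fst q)))"
    and w: "\<And>p. p \<in> full_idx k \<Longrightarrow> w p \<noteq> 0"
    and p: "p \<in> full_idx k"
  shows "c p = 0"
proof -
  have div: "(\<Sum>q | q \<in> bubble_idx k \<and> lower (fst q) (snd q) = m. c q * real (snd q (fst q))) = 0"
    (is "sum ?g (?D m) = 0") for m
  proof (cases "?D m = {}")
    case True
    then show ?thesis by (simp only: sum.empty)
  next
    case False
    then obtain i a where "(i, a) \<in> bubble_idx k" and m: "lower i a = m" by auto
    \<comment> \<open>Lowering in direction \<open>i\<close> preserves the maximal exponent in the other direction \<open>l\<close>.\<close>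
    then obtain l where "l \<noteq> i" "a l = k" by (auto simp: bubble_idx_def)
    with m have l: "m l = k" by (auto simp: lower_def)
    then have "(l, raise l m) \<notin> full_idx k"
      by (auto simp: full_idx_def raise_def intro!: exI[of _ l])
    moreover have "raise l b = raise l m \<longleftrightarrow> b = m" for b
      by (auto simp: raise_def fun_eq_iff split: if_splits)
    ultimately show ?thesis using eq[of l "raise l m"] by simp
  qed
  obtain j m where jm: "p = (j, m)" by (cases p)
  have "w (j, m) * c (j, m) = 0"
  proof (cases "m j = 0")
    case True
    then show ?thesis using eq[of j m] p by (simp add: jm raise_eq_iff)
  next
    case False
    then show ?thesis using eq[of j m] p div[of "lower j m"] by (simp add: jm raise_eq_iff)
  qed
  with w[OF p] show ?thesis by (simp add: jm)
qed

lemma V_basis_coefficients_zero: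
  fixes c :: "'n::finite \<times> ('n \<Rightarrow> nat) \<Rightarrow> real"
  assumes zero: "(\<Sum>p\<in>full_idx k. c p *\<^sub>R V_basis k p) = 0"
  shows "\<forall>p\<in>full_idx k. c p = 0"
proof -
  let ?P = "full_idx k :: ('n \<times> ('n \<Rightarrow> nat)) set"
  let ?B = "bubble_idx k :: ('n \<times> ('n \<Rightarrow> nat)) set"
  define w :: "'n \<times> ('n \<Rightarrow> nat) \<Rightarrow> real" where "w p = (if p \<in> ?B then bubble_weight (fst p) (snd p) else 1)" for p
  define s :: "'n \<times> ('n \<Rightarrow> nat) \<Rightarrow> real" where "s p = (if p \<in> ?B then real (snd p (fst p)) else 0)" for p
  have BP: "?B \<subseteq> ?P" by (simp add: idx_partition)
  have fin: "finite ?P" by (rule finite_full_idx)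
  have finB: "finite ?B" using BP fin by (rule finite_subset)
  have "(if (j, m) \<in> ?P then w (j, m) * c (j, m) else 0)
      = (\<Sum>q | q \<in> ?B \<and> raise j (lower (fst q) (snd q)) = m. c q * real (snd q (fst q)))" for j m
  proof -
    \<comment> \<open>A bubble generator can contribute two monomials to the same component. The disjoint sum of the
      index sets lists both contributions in a single family.\<close>
    define d where "d = case_sum (\<lambda>p. if fst p = j then w p * c p else 0)
      (\<lambda>q. - (c q * real (snd q (fst q))))"
    define \<mu> :: "('n \<times> ('n \<Rightarrow> nat)) + ('n \<times> ('n \<Rightarrow> nat)) \<Rightarrow> 'n \<Rightarrow> nat"
      where "\<mu> = case_sum snd (\<lambda>q. raise j (lower (fst q) (snd q)))"
    have "(\<Sum>p\<in>?P <+> ?B. d p * mono_fun (\<mu> p) x) = 0" if x: "x \<in> ref_elem" for x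
    proof -
      have field: "V_basis k p x $ j = (if fst p = j then w p * mono_fun (snd p) x else 0)
          - s p * mono_fun (raise j (lower (fst p) (snd p))) x" for p
        using x by (auto simp: V_basis_def w_def s_def bubble_gen_nth mono_field_def
            comp_field_nth on_ref_def)
      have "0 = (\<Sum>p\<in>?P. c p *\<^sub>R V_basis k p) x $ j" by (simp add: zero)
      also have "\<dots> = (\<Sum>p\<in>?P. c p * V_basis k p x $ j)"
        by (simp add: scaleR_fun_def sum_fun_apply)
      also have "\<dots> = (\<Sum>p\<in>?P. (if fst p = j then w p * c p else 0) * mono_fun (snd p) x)
          - (\<Sum>p\<in>?P. c p * s p * mono_fun (raise j (lower (fst p) (snd p))) x)"
        unfolding sum_subtractf[symmetric]
        by (intro sum.cong) (auto simp: field algebra_simps)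
      also have "(\<Sum>p\<in>?P. c p * s p * mono_fun (raise j (lower (fst p) (snd p))) x)
          = (\<Sum>q\<in>?B. c q * real (snd q (fst q)) * mono_fun (raise j (lower (fst q) (snd q))) x)"
        using fin BP by (intro sum.mono_neutral_cong_right) (auto simp: s_def)
      finally show ?thesis
        using fin finB by (simp add: sum.Plus d_def \<mu>_def sum_negf)
    qed
    from coefficients_vanish[OF _ this, of m] fin finB
    have "(\<Sum>p | p \<in> ?P <+> ?B \<and> \<mu> p = m. d p) = 0" by simp
    also have "{p. p \<in> ?P <+> ?B \<and> \<mu> p = m} = {p \<in> ?P. snd p = m}
        <+> {q \<in> ?B. raise j (lower (fst q) (snd q)) = m}"
      by (auto simp: \<mu>_def)
    also have "sum d \<dots> = (\<Sum>p | p \<in> ?P \<and> snd p = m. if fst p = j then w p * c p else 0)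
        - (\<Sum>q | q \<in> ?B \<and> raise j (lower (fst q) (snd q)) = m. c q * real (snd q (fst q)))"
      using fin finB by (simp add: sum.Plus d_def sum_negf)
    also have "(\<Sum>p | p \<in> ?P \<and> snd p = m. if fst p = j then w p * c p else 0)
        = (\<Sum>p\<in>?P. if p = (j, m) then w p * c p else 0)"
      using fin by (intro sum.mono_neutral_cong_left) auto
    also have "\<dots> = (if (j, m) \<in> ?P then w (j, m) * c (j, m) else 0)"
      using fin by simp
    finally show ?thesis by simp
  qed
  moreover have "w p \<noteq> 0" for p
    using bubble_weight_pos[of "fst p" "snd p" k] by (auto simp: w_def)
  ultimately show ?thesis
    using bubble_equations_force_zero[of k w c] by blast
qed

lemma mono_field_coefficients_zero:
  fixes c :: "'n::finite \<times> ('n \<Rightarrow> nat) \<Rightarrow> real"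
  assumes zero: "(\<Sum>p\<in>full_idx k. c p *\<^sub>R mono_field p) = 0"
  shows "\<forall>p\<in>full_idx k. c p = 0"
proof clarify
  fix j :: 'n and m assume jm: "(j, m) \<in> full_idx k"
  let ?P = "full_idx k :: ('n \<times> ('n \<Rightarrow> nat)) set"
  have fin: "finite ?P" by (rule finite_full_idx)
  have "(\<Sum>p\<in>?P. (if fst p = j then c p else 0) * mono_fun (snd p) x) = 0"
    if x: "x \<in> ref_elem" for x
  proof -
    have "0 = (\<Sum>p\<in>?P. c p *\<^sub>R mono_field p) x $ j" by (simp add: zero)
    also have "\<dots> = (\<Sum>p\<in>?P. c p * mono_field p x $ j)"
      by (simp add: scaleR_fun_def sum_fun_apply)
    also have "\<dots> = (\<Sum>p\<in>?P. (if fst p = j then c p else 0) * mono_fun (snd p) x)"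
      using x by (intro sum.cong) (auto simp: mono_field_def comp_field_nth on_ref_def)
    finally show ?thesis by simp
  qed
  from coefficients_vanish[OF fin this, of m]
  have "0 = (\<Sum>p | p \<in> ?P \<and> snd p = m. if fst p = j then c p else 0)" by simp
  also have "\<dots> = (\<Sum>p\<in>?P. if p = (j, m) then c p else 0)"
    using fin by (intro sum.mono_neutral_cong_left) auto
  also have "\<dots> = c (j, m)" using fin jm by simp
  finally show "c (j, m) = 0" by simp
qed

theorem theorem2p1:
  fixes k :: nat
  assumes "CARD('n::finite) = 2 \<or> CARD('n) = 3"
    and "k \<ge> 1"
  shows "is_direct_sum (V_space k :: (real ^ 'n \<Rightarrow> real ^ 'n) set)
           (RT_space (k - 1)) (bubble_space k)
       \<and> dim (V_space k :: (real ^ 'n \<Rightarrow> real ^ 'n) set)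
         = dim (Q_vec_space k :: (real ^ 'n \<Rightarrow> real ^ 'n) set)"
proof -
  let ?P = "full_idx k :: ('n \<times> ('n \<Rightarrow> nat)) set"
  let ?F = "V_basis k :: 'n \<times> ('n \<Rightarrow> nat) \<Rightarrow> _"
  let ?A = "?F ` RT_idx k" and ?B = "?F ` bubble_idx k"
  have V: "inj_on ?F ?P" "independent (?F ` ?P)"
    by (rule independent_family[OF finite_full_idx], erule V_basis_coefficients_zero)+
  have Q: "inj_on mono_field ?P" "independent (mono_field ` ?P)"
    by (rule independent_family[OF finite_full_idx], erule mono_field_coefficients_zero)+
  have "?A = mono_field ` RT_idx k"
    using idx_partition(2)[of k] by (intro image_cong) (auto simp: V_basis_def)
  then have RT: "RT_space (k - 1) = span ?A"
    using \<open>k \<ge> 1\<close> by (simp add: RT_space_span)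
  have "?B = (\<lambda>(i, a). bubble_gen i a) ` bubble_idx k"
    by (intro image_cong) (auto simp: V_basis_def)
  then have bubble: "bubble_space k = span ?B"
    by (simp add: bubble_space_span)
  have AB: "?A \<union> ?B = ?F ` ?P"
    by (simp add: idx_partition(1) image_Un)
  have "?A \<inter> ?B = ?F ` (RT_idx k \<inter> bubble_idx k)"
    using V(1) by (intro inj_on_image_Int[symmetric]) (auto simp: idx_partition(1))
  then have disj: "?A \<inter> ?B = {}" by (simp add: idx_partition(2))
  have "V_space k = span (?F ` ?P)"
    by (simp only: V_space_def RT bubble sum_of_spans AB)
  then have "dim (V_space k :: (real ^ 'n \<Rightarrow> real ^ 'n) set) = card ?P"
    using V by (simp add: dim_eq_card_independent card_image)
  moreover have "dim (Q_vec_space k :: (real ^ 'n \<Rightarrow> real ^ 'n) set) = card ?P"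
    using Q by (simp add: Q_vec_space_span dim_eq_card_independent card_image)
  moreover have "span ?A \<inter> span ?B = {0}"
    using V(2) disj by (intro span_Int_span_of_disjoint) (simp_all add: AB)
  ultimately show ?thesis
    unfolding is_direct_sum_def V_space_def RT bubble by simp
qed

end
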